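(* Every countable very strong HFD space $X\subset 2^{\omega_1}$ is R-nw-selective.
   Context: $\mathrm{Fin}(I,2)$ is the collection of all finite partial functions from $I$ to $2$; for $s\in\mathrm{Fin}(\omega_1,2)$, $[s]=\{f\in 2^{\omega_1}:s\subset f\}$. A set $X\subset 2^{\omega_1}$ (with the subspace topology of the product topology) is a very strong HFD if for each sequence $\{A_n:n\in\omega\}$ of pairwise disjoint, non-empty finite subsets of $X$ there is $\beta<\omega_1$ such that for all $s\in\mathrm{Fin}(\omega_1\setminus\beta,2)$ there are infinitely many $n$ with $A_n\subset[s]$. A network for a space $X$ is a family $\mathcal N$ of subsets of $X$ such that for every $x\in X$ and every open neighbourhood $U$ of $x$ there is $N\in\mathcal N$ with $x\in N\subseteq U$; $nw(X)=\omega$ is understood as: $X$ has a countable network. $X$ is R-nw-selective if $nw(X)=\omega$ and for every sequence $(\mathcal N_n:n\in\omega)$ of countable networks for $X$ one can pick $N_n\in\mathcal N_n$, $n\in\omega$, such that $\{N_n:n\in\omega\}$ is a network for $X$. *)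

theory Defs
  imports "HOL-Analysis.Analysis"
begin

section \<open>The ordinal \<open>\<omega>\<^sub>1\<close>\<close>

text \<open>
  The type \<open>omega1\<close> is the field of the well-order \<open>cardSuc natLeq\<close> (the cardinal successor of
  \<open>\<omega>\<close>), with that order. The lemmas \<open>uncountable_omega1\<close> and \<open>countable_lessThan_omega1\<close>
  characterise \<open>\<omega>\<^sub>1\<close> among the well-orders.
\<close>

typedef omega1 = "Field (cardSuc natLeq)"
proof -
  have "infinite (Field (cardSuc natLeq))"
    using cardSuc_finite[OF natLeq_Card_order] Field_natLeq by simp
  then have "Field (cardSuc natLeq) \<noteq> {}"
    by (intro notI) simp
  then show ?thesis
    by blast
qed

lemma Well_order_cardSuc_natLeq: "Well_order (cardSuc natLeq)"
  using cardSuc_Card_order[OF natLeq_Card_order] card_order_on_well_order_on by blast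

instantiation omega1 :: wellorder
begin

definition less_eq_omega1 :: "omega1 \<Rightarrow> omega1 \<Rightarrow> bool" where
  "\<alpha> \<le> \<beta> \<longleftrightarrow> (Rep_omega1 \<alpha>, Rep_omega1 \<beta>) \<in> cardSuc natLeq"

definition less_omega1 :: "omega1 \<Rightarrow> omega1 \<Rightarrow> bool" where
  "\<alpha> < \<beta> \<longleftrightarrow> \<alpha> \<le> \<beta> \<and> \<not> \<beta> \<le> (\<alpha>::omega1)"

instance
proof -
  let ?r = "cardSuc natLeq"
  have lin: "refl_on (Field ?r) ?r" "trans ?r" "antisym ?r" "total_on (Field ?r) ?r"
    and wf: "wf (?r - Id)"
    using Well_order_cardSuc_natLeq
    unfolding well_order_on_def linear_order_on_def partial_order_on_def preorder_on_def by auto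
  have refl: "\<alpha> \<le> \<alpha>" for \<alpha> :: omega1
    unfolding less_eq_omega1_def using lin(1) Rep_omega1 by (auto dest: refl_onD)
  have trans: "\<alpha> \<le> \<gamma>" if "\<alpha> \<le> \<beta>" "\<beta> \<le> \<gamma>" for \<alpha> \<beta> \<gamma> :: omega1
    using that lin(2) unfolding less_eq_omega1_def by (meson transD)
  have antisym: "\<alpha> = \<beta>" if "\<alpha> \<le> \<beta>" "\<beta> \<le> \<alpha>" for \<alpha> \<beta> :: omega1
    using that lin(3) unfolding less_eq_omega1_def by (meson antisymD Rep_omega1_inject)
  have total: "\<alpha> \<le> \<beta> \<or> \<beta> \<le> \<alpha>" for \<alpha> \<beta> :: omega1
  proof (cases "\<alpha> = \<beta>")
    case True
    then show ?thesis using refl by simp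
  next
    case False
    then have "Rep_omega1 \<alpha> \<noteq> Rep_omega1 \<beta>" by (simp add: Rep_omega1_inject)
    then show ?thesis
      using lin(4) Rep_omega1 unfolding less_eq_omega1_def total_on_def by blast
  qed
  have induct: "P \<alpha>" if "\<And>\<alpha>. (\<And>\<beta>. \<beta> < \<alpha> \<Longrightarrow> P \<beta>) \<Longrightarrow> P \<alpha>" for P and \<alpha> :: omega1
  proof -
    have "wf (inv_image (?r - Id) Rep_omega1)"
      using wf by (rule wf_inv_image)
    then show ?thesis
    proof (induction \<alpha> rule: wf_induct_rule)
      case (less \<alpha>)
      show ?case
      proof (rule that)
        fix \<beta> assume "\<beta> < \<alpha>"
        then have "(\<beta>, \<alpha>) \<in> inv_image (?r - Id) Rep_omega1"
          unfolding less_omega1_def less_eq_omega1_def by auto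
        then show "P \<beta>" by (rule less)
      qed
    qed
  qed
  show "OFCLASS(omega1, wellorder_class)"
    by intro_classes (fact less_omega1_def refl trans antisym total induct)+
qed

end

lemma uncountable_omega1:
  includes cardinal_syntax
  shows "uncountable (UNIV :: omega1 set)"
proof
  assume "countable (UNIV :: omega1 set)"
  then have "countable (Rep_omega1 ` UNIV)"
    by (rule countable_image)
  then have "countable (Field (cardSuc natLeq))"
    by (simp add: type_definition.Rep_range[OF type_definition_omega1])
  then obtain f :: "nat set \<Rightarrow> nat" where "inj_on f (Field (cardSuc natLeq))"
    by (auto simp: countable_def)
  then have "|Field (cardSuc natLeq)| \<le>o |UNIV :: nat set|"
    by (auto simp: card_of_ordLeq[symmetric])
  moreover have "|UNIV :: nat set| =o natLeq"
    using card_of_Field_natLeq Field_natLeq by simp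
  moreover have "cardSuc natLeq =o |Field (cardSuc natLeq)|"
    using card_of_Field_ordIso[OF cardSuc_Card_order[OF natLeq_Card_order]] ordIso_symmetric
    by blast
  ultimately have "cardSuc natLeq \<le>o natLeq"
    by (meson ordIso_ordLeq_trans ordLeq_ordIso_trans)
  then show False
    using cardSuc_greater[OF natLeq_Card_order] not_ordLess_ordLeq by blast
qed

lemma countable_lessThan_omega1:
  includes cardinal_syntax
  shows "countable {..<\<beta> :: omega1}"
proof -
  have "|underS (cardSuc natLeq) (Rep_omega1 \<beta>)| <o cardSuc natLeq"
    using card_of_underS[OF cardSuc_Card_order[OF natLeq_Card_order]] Rep_omega1 by blast
  then have "|underS (cardSuc natLeq) (Rep_omega1 \<beta>)| \<le>o natLeq"
    using cardSuc_ordLeq_ordLess[OF natLeq_Card_order card_of_Card_order] by blast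
  moreover have "natLeq =o |UNIV :: nat set|"
    using card_of_Field_natLeq Field_natLeq ordIso_symmetric by fastforce
  ultimately have "|underS (cardSuc natLeq) (Rep_omega1 \<beta>)| \<le>o |UNIV :: nat set|"
    by (rule ordLeq_ordIso_trans)
  then have "countable (underS (cardSuc natLeq) (Rep_omega1 \<beta>))"
    by (auto simp: card_of_ordLeq[symmetric] countable_def)
  moreover have "Rep_omega1 ` {..<\<beta>} \<subseteq> underS (cardSuc natLeq) (Rep_omega1 \<beta>)"
    by (auto simp: underS_def less_omega1_def less_eq_omega1_def)
  ultimately have "countable (Rep_omega1 ` {..<\<beta>})"
    using countable_subset by blast
  then show ?thesis
    using countable_image_inj_on[of Rep_omega1] Rep_omega1_inject by (meson inj_onI)
qed


section \<open>Very strong HFD sets in \<open>2\<^bsup>\<omega>\<^sub>1\<^esup>\<close>\<close>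

text \<open>The discrete space \<open>2\<close> is represented by \<open>bool\<close>.\<close>

definition Fin2 :: "'i set \<Rightarrow> ('i \<rightharpoonup> bool) set" where
  "Fin2 I = {s. finite (dom s) \<and> dom s \<subseteq> I}"

definition cylinder :: "('i \<rightharpoonup> bool) \<Rightarrow> ('i \<Rightarrow> bool) set" where
  "cylinder s = {f. s \<subseteq>\<^sub>m (\<lambda>i. Some (f i))}"

definition cantor_omega1 :: "(omega1 \<Rightarrow> bool) topology" where
  "cantor_omega1 = product_topology (\<lambda>_. discrete_topology UNIV) UNIV"

text \<open>Note that \<open>{\<beta>..}\<close> is \<open>\<omega>\<^sub>1 \<setminus> \<beta>\<close>, the ordinal \<open>\<beta>\<close> being the set of its predecessors.\<close>

definition very_strong_HFD :: "(omega1 \<Rightarrow> bool) set \<Rightarrow> bool" where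
  "very_strong_HFD X \<longleftrightarrow>
    (\<forall>A :: nat \<Rightarrow> (omega1 \<Rightarrow> bool) set.
      disjoint_family A \<and> (\<forall>n. A n \<noteq> {} \<and> finite (A n) \<and> A n \<subseteq> X) \<longrightarrow>
      (\<exists>\<beta>. \<forall>s \<in> Fin2 {\<beta>..}. infinite {n. A n \<subseteq> cylinder s}))"


section \<open>Networks and R-nw-selectivity\<close>

definition network_of :: "'a topology \<Rightarrow> 'a set set \<Rightarrow> bool" where
  "network_of T \<N> \<longleftrightarrow>
    (\<forall>N \<in> \<N>. N \<subseteq> topspace T) \<and>
    (\<forall>x \<in> topspace T. \<forall>U. openin T U \<and> x \<in> U \<longrightarrow> (\<exists>N \<in> \<N>. x \<in> N \<and> N \<subseteq> U))"

definition R_nw_selective :: "'a topology \<Rightarrow> bool" where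
  "R_nw_selective T \<longleftrightarrow>
    (\<exists>\<N>. countable \<N> \<and> network_of T \<N>) \<and>
    (\<forall>\<N> :: nat \<Rightarrow> 'a set set.
      (\<forall>n. countable (\<N> n) \<and> network_of T (\<N> n)) \<longrightarrow>
      (\<exists>N. (\<forall>n. N n \<in> \<N> n) \<and> network_of T (range N)))"

end

theory Submission
  imports Defs
begin

text \<open>
  Singletons form a countable network, so the point is the selection from a sequence
  of countable networks. Two consequences of the HFD property drive it.

  An infinite subset of \<open>X\<close> takes both values at every coordinate beyond some countable
  ordinal (the HFD property for singletons). As there are only countably many members of the
  given networks, one coordinate splits all the infinite ones. Small neighbourhoods therefore
  contain no infinite member, and the finite members alone still form networks
  (\<open>finite_member_below_neighbourhood\<close>).

  Next, fix a point \<open>x\<close> and a cylinder \<open>[t]\<close> around it. From infinitely many of the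
  networks one can select finite members with \<open>x \<in> N\<^sub>k \<subseteq> [t]\<close> that are pairwise disjoint apart
  from \<open>x\<close>. Unless some \<open>N\<^sub>k\<close> can be taken to be \<open>{x}\<close>, which is better still, the HFD property
  of the sets \<open>N\<^sub>k - {x}\<close> yields \<open>\<beta>\<close> such that each cylinder around \<open>x\<close> with support above
  \<open>\<beta>\<close> contains some \<open>N\<^sub>k\<close> (\<open>selection_at_point\<close>). So the coordinates above \<open>\<beta>\<close> take care of
  themselves, and those below \<open>\<beta>\<close> should be prescribed by \<open>t\<close>; the difficulty is
  that \<open>\<beta>\<close> depends on \<open>t\<close>.

  This circle is broken by closing off: some \<open>\<delta> < \<omega>\<^sub>1\<close> bounds the ordinals \<open>\<beta>\<close> of all \<open>t\<close>
  supported below \<open>\<delta>\<close> (\<open>closing_off_point\<close>). There are only countably many pairs \<open>(x, t)\<close> with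
  such \<open>t\<close>, so each of them can be given its own infinite set of networks to select from. Any
  finite condition satisfied by \<open>x\<close> splits at \<open>\<delta>\<close> into a part \<open>t\<close> below, whose cylinder contains
  all members selected for \<open>(x, t)\<close>, and a part above, whose cylinder contains one of them.
\<close>

section \<open>Closing off in \<open>\<omega>\<^sub>1\<close>\<close>

lemma countable_Fin2:
  assumes "countable I"
  shows "countable (Fin2 I)"
proof -
  have "finite {s :: 'a \<rightharpoonup> bool. dom s = D}" if "finite D" for D :: "'a set"
    using finite_set_of_finite_maps[OF that, of "UNIV :: bool set"] by simp
  then have "countable (\<Union>D \<in> {D. finite D \<and> D \<subseteq> I}. {s :: 'a \<rightharpoonup> bool. dom s = D})"
    using countable_Collect_finite_subset[OF assms]
    by (intro countable_UN) (auto intro: countable_finite simp: conj_commute)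
  then show ?thesis
    by (rule countable_subset[rotated]) (auto simp: Fin2_def)
qed

lemma countable_bounded_omega1:
  fixes S :: "omega1 set"
  assumes "countable S"
  shows "\<exists>b. \<forall>\<alpha>\<in>S. \<alpha> \<le> b"
proof -
  have "countable (\<Union>\<alpha>\<in>S. {..<\<alpha>})"
    by (intro countable_UN assms countable_lessThan_omega1)
  then have "(\<Union>\<alpha>\<in>S. {..<\<alpha>}) \<noteq> UNIV"
    using uncountable_omega1 by auto
  then obtain b where "\<forall>\<alpha>\<in>S. \<not> b < \<alpha>"
    by auto
  then show ?thesis
    by (meson not_less)
qed

text \<open>
  The least upper bound of an increasing \<open>\<omega>\<close>-sequence in which each term bounds the values of
  \<open>B\<close> on the conditions supported below its predecessor: a finite support below the limit
  already lies below one of the terms.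
\<close>

lemma closing_off_point:
  fixes B :: "(omega1 \<rightharpoonup> bool) \<Rightarrow> omega1"
  obtains \<delta> where "\<And>t. t \<in> Fin2 {..<\<delta>} \<Longrightarrow> B t \<le> \<delta>"
proof -
  have "\<exists>c. b \<le> c \<and> (\<forall>t \<in> Fin2 {..<b}. B t \<le> c)" for b
  proof -
    have "countable (insert b (B ` Fin2 {..<b}))"
      by (simp add: countable_Fin2 countable_lessThan_omega1)
    then obtain c where "\<forall>\<alpha> \<in> insert b (B ` Fin2 {..<b}). \<alpha> \<le> c"
      using countable_bounded_omega1 by blast
    then have "b \<le> c \<and> (\<forall>t \<in> Fin2 {..<b}. B t \<le> c)"
      by simp
    then show ?thesis ..
  qed
  then obtain f where f: "\<And>b. b \<le> f b" "\<And>b t. t \<in> Fin2 {..<b} \<Longrightarrow> B t \<le> f b"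
    by metis
  \<comment> \<open>The iteration may start at any ordinal.\<close>
  define b where "b n = (f ^^ n) undefined" for n :: nat
  have b_Suc: "b (Suc n) = f (b n)" for n
    by (simp add: b_def)
  have "mono b"
    by (rule incseq_SucI) (simp add: b_Suc f(1))
  obtain u where "\<forall>n. b n \<le> u"
    using countable_bounded_omega1[of "range b"] by auto
  define \<delta> where "\<delta> = (LEAST u. \<forall>n. b n \<le> u)"
  have upper: "b n \<le> \<delta>" for n
    using LeastI[of "\<lambda>u. \<forall>n. b n \<le> u", OF \<open>\<forall>n. b n \<le> u\<close>] by (simp add: \<delta>_def)
  have cofinal: "\<exists>n. \<alpha> < b n" if "\<alpha> < \<delta>" for \<alpha>
    using not_less_Least[of \<alpha> "\<lambda>u. \<forall>n. b n \<le> u"] that by (auto simp: \<delta>_def not_le)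
  have below: "\<exists>n. D \<subseteq> {..<b n}" if "finite D" "D \<subseteq> {..<\<delta>}" for D
    using that
  proof (induction D rule: finite_induct)
    case (insert \<alpha> D)
    obtain m where "\<alpha> < b m"
      using cofinal[of \<alpha>] insert.prems by auto
    moreover obtain n where "D \<subseteq> {..<b n}"
      using insert.IH insert.prems by auto
    moreover have "b m \<le> b (max m n)" "b n \<le> b (max m n)"
      using \<open>mono b\<close> by (auto intro: monoD)
    ultimately have "insert \<alpha> D \<subseteq> {..<b (max m n)}"
      by (auto intro: less_le_trans)
    then show ?case ..
  qed simp
  have "B t \<le> \<delta>" if t: "t \<in> Fin2 {..<\<delta>}" for t
  proof -
    obtain n where "dom t \<subseteq> {..<b n}"
      using t below[of "dom t"] by (auto simp: Fin2_def)
    then have "B t \<le> b (Suc n)"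
      using t f(2) by (simp add: Fin2_def b_Suc)
    then show ?thesis
      using upper order_trans by blast
  qed
  then show thesis
    by (rule that)
qed


section \<open>Cylinders as basic open sets\<close>

lemma mem_cylinder_iff: "f \<in> cylinder s \<longleftrightarrow> (\<forall>i\<in>dom s. s i = Some (f i))"
  by (simp add: cylinder_def map_le_def)

lemma topspace_cantor_omega1 [simp]: "topspace cantor_omega1 = UNIV"
  by (simp add: cantor_omega1_def)

lemma t1_space_cantor_omega1: "t1_space cantor_omega1"
  unfolding cantor_omega1_def
  by (intro Hausdorff_imp_t1_space) (simp add: Hausdorff_space_product_topology)

lemma openin_cylinder:
  assumes "finite (dom s)"
  shows "openin cantor_omega1 (cylinder s)"
proof -
  have "(i \<in> dom s \<longrightarrow> s i = Some (f i)) \<longleftrightarrow> f i \<in> (if i \<in> dom s then {the (s i)} else UNIV)"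
    for f i
    by (cases "s i") auto
  then have "f \<in> cylinder s \<longleftrightarrow> f \<in> (\<Pi>\<^sub>E i\<in>UNIV. if i \<in> dom s then {the (s i)} else UNIV)" for f
    by (simp only: mem_cylinder_iff PiE_UNIV_domain Pi_iff Ball_def) simp
  then have "cylinder s = (\<Pi>\<^sub>E i\<in>UNIV. if i \<in> dom s then {the (s i)} else UNIV)"
    by blast
  then show ?thesis
    using assms unfolding cantor_omega1_def
    by (auto simp: openin_PiE_gen elim!: finite_subset[rotated])
qed

lemma cylinder_in_neighbourhood:
  assumes "openin cantor_omega1 U" and "x \<in> U"
  obtains s where "s \<in> Fin2 UNIV" and "x \<in> cylinder s" and "cylinder s \<subseteq> U"
proof -
  obtain V where V: "finite {i. V i \<noteq> UNIV}" "x \<in> Pi\<^sub>E UNIV V" "Pi\<^sub>E UNIV V \<subseteq> U"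
    using assms unfolding cantor_omega1_def openin_product_topology_alt by auto
  define s where "s i = (if V i \<noteq> UNIV then Some (x i) else None)" for i
  have dom_s: "dom s = {i. V i \<noteq> UNIV}"
    by (auto simp: s_def split: if_splits)
  show thesis
  proof
    show "s \<in> Fin2 UNIV"
      using V(1) dom_s by (simp add: Fin2_def)
    show "x \<in> cylinder s"
      unfolding mem_cylinder_iff dom_s by (simp add: s_def)
    have "f \<in> Pi\<^sub>E UNIV V" if "f \<in> cylinder s" for f
    proof -
      have eq: "V i = UNIV \<or> f i = x i" for i
        using that unfolding mem_cylinder_iff dom_s by (auto simp: s_def)
      have mem: "x i \<in> V i" for i
        using V(2) by auto
      have "f i \<in> V i" for i
        using eq[of i] mem[of i] by (elim disjE) simp_all
      then show ?thesis
        by (simp add: PiE_iff)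
    qed
    then show "cylinder s \<subseteq> U"
      using V(3) by blast
  qed
qed


section \<open>Discarding the infinite members of a network\<close>

lemma infinite_subset_splits:
  assumes "very_strong_HFD X" and "N \<subseteq> X" and "infinite N"
  obtains \<beta> where "\<And>\<gamma> v. \<beta> \<le> \<gamma> \<Longrightarrow> \<exists>f\<in>N. f \<gamma> = v"
proof -
  obtain y :: "nat \<Rightarrow> omega1 \<Rightarrow> bool" where y: "inj y" "range y \<subseteq> N"
    using infinite_countable_subset[OF assms(3)] by blast
  have "disjoint_family (\<lambda>n. {y n})"
    using y(1) by (auto simp: disjoint_family_on_def inj_def)
  moreover have "\<forall>n. {y n} \<noteq> {} \<and> finite {y n} \<and> {y n} \<subseteq> X"
    using y(2) assms(2) by auto
  ultimately obtain \<beta>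
    where \<beta>: "\<And>s. s \<in> Fin2 {\<beta>..} \<Longrightarrow> infinite {n. {y n} \<subseteq> cylinder s}"
    using assms(1) unfolding very_strong_HFD_def by meson
  have "\<exists>f\<in>N. f \<gamma> = v" if "\<beta> \<le> \<gamma>" for \<gamma> v
  proof -
    have "[\<gamma> \<mapsto> v] \<in> Fin2 {\<beta>..}"
      using that by (simp add: Fin2_def)
    then have "{n. {y n} \<subseteq> cylinder [\<gamma> \<mapsto> v]} \<noteq> {}"
      using \<beta> by (metis finite.emptyI)
    then obtain n where "y n \<in> cylinder [\<gamma> \<mapsto> v]"
      by blast
    then have "y n \<gamma> = v"
      by (simp add: mem_cylinder_iff)
    then show ?thesis
      using y(2) by blast
  qed
  then show thesis
    by (rule that)
qed

text \<open>
  Take a coordinate \<open>\<gamma>\<close> that splits every infinite member of the network. A member inside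
  \<open>U \<inter> {f. f \<gamma> = x \<gamma>}\<close> cannot be split at \<open>\<gamma>\<close>.
\<close>

lemma finite_member_below_neighbourhood:
  assumes HFD: "very_strong_HFD X"
    and net: "countable \<N>" "network_of (subtopology cantor_omega1 X) \<N>"
    and U: "openin (subtopology cantor_omega1 X) U" "x \<in> U"
  obtains N where "N \<in> \<N>" "finite N" "x \<in> N" "N \<subseteq> U"
proof -
  have sub: "N \<subseteq> X" if "N \<in> \<N>" for N
    using net(2) that by (auto simp: network_of_def)
  have "\<exists>\<beta>. \<forall>\<gamma> v. \<beta> \<le> \<gamma> \<longrightarrow> (\<exists>f\<in>N. f \<gamma> = v)" if "N \<in> \<N>" "infinite N" for N
    using infinite_subset_splits[OF HFD sub[OF that(1)] that(2)] by metis
  then obtain \<beta> where \<beta>: "\<And>N \<gamma> v. N \<in> \<N> \<Longrightarrow> infinite N \<Longrightarrow> \<beta> N \<le> \<gamma> \<Longrightarrow> \<exists>f\<in>N. f \<gamma> = v"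
    by metis
  obtain \<gamma> where \<gamma>: "\<And>N. N \<in> \<N> \<Longrightarrow> \<beta> N \<le> \<gamma>"
    using countable_bounded_omega1[of "\<beta> ` \<N>"] net(1) by auto
  define W where "W = U \<inter> cylinder [\<gamma> \<mapsto> x \<gamma>]"
  have "U \<subseteq> X"
    using openin_subset[OF U(1)] by simp
  have "openin (subtopology cantor_omega1 X) (X \<inter> cylinder [\<gamma> \<mapsto> x \<gamma>])"
    by (intro openin_subtopology_Int2 openin_cylinder) simp
  then have "openin (subtopology cantor_omega1 X) (U \<inter> (X \<inter> cylinder [\<gamma> \<mapsto> x \<gamma>]))"
    by (rule openin_Int[OF U(1)])
  moreover have "U \<inter> (X \<inter> cylinder [\<gamma> \<mapsto> x \<gamma>]) = W"
    using \<open>U \<subseteq> X\<close> by (auto simp: W_def)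
  ultimately have "openin (subtopology cantor_omega1 X) W"
    by (simp only:)
  moreover have "x \<in> W"
    using U(2) by (simp add: W_def mem_cylinder_iff)
  moreover have "x \<in> X"
    using U(2) \<open>U \<subseteq> X\<close> by blast
  moreover have "\<forall>x\<in>X. \<forall>U. openin (subtopology cantor_omega1 X) U \<and> x \<in> U \<longrightarrow>
      (\<exists>N\<in>\<N>. x \<in> N \<and> N \<subseteq> U)"
    using net(2) by (simp add: network_of_def)
  ultimately obtain N where N: "N \<in> \<N>" "x \<in> N" "N \<subseteq> W"
    by meson
  have "\<forall>f\<in>N. f \<gamma> = x \<gamma>"
    using N(3) by (auto simp: W_def mem_cylinder_iff)
  then have "\<not> (\<exists>f\<in>N. f \<gamma> = (\<not> x \<gamma>))"
    by simp
  then have "finite N"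
    using \<beta> \<gamma> N(1) by blast
  then show thesis
    using that N by (auto simp: W_def)
qed


section \<open>Selection at a single point\<close>

text \<open>
  The sets \<open>g k - {x}\<close> are made pairwise disjoint by recursion: the points other than \<open>x\<close> used
  before stage \<open>k\<close> form a finite, hence closed, set, and \<open>g k\<close> is taken inside its complement.
  The HFD property then applies to them unless one of them is empty.
\<close>

lemma selection_at_point:
  fixes M :: "nat \<Rightarrow> (omega1 \<Rightarrow> bool) set set"
  assumes HFD: "very_strong_HFD X"
    and net: "\<And>k. countable (M k)" "\<And>k. network_of (subtopology cantor_omega1 X) (M k)"
    and t: "t \<in> Fin2 UNIV" "x \<in> cylinder t" and "x \<in> X"
  shows "\<exists>g \<beta>. (\<forall>k. g k \<in> M k \<and> x \<in> g k \<and> g k \<subseteq> cylinder t) \<and>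
    (\<forall>s \<in> Fin2 {\<beta>..}. x \<in> cylinder s \<longrightarrow> (\<exists>k. g k \<subseteq> cylinder s))"
proof -
  let ?T = "subtopology cantor_omega1 X"
  have choice: "\<exists>N. N \<in> M k \<and> finite N \<and> x \<in> N \<and> N \<subseteq> cylinder t \<and> (N - {x}) \<inter> F = {}"
    if "finite F" for k F
  proof -
    have "closedin cantor_omega1 (F - {x})"
      using t1_space_cantor_omega1 that
      by (auto simp: t1_space_closedin_finite cantor_omega1_def)
    then have "openin cantor_omega1 (cylinder t - (F - {x}))"
      using openin_cylinder[of t] t(1) by (auto simp: Fin2_def)
    then have "openin ?T (X \<inter> (cylinder t - (F - {x})))"
      by (rule openin_subtopology_Int2)
    moreover have "x \<in> X \<inter> (cylinder t - (F - {x}))"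
      using t(2) \<open>x \<in> X\<close> by blast
    ultimately obtain N where "N \<in> M k" "finite N" "x \<in> N" "N \<subseteq> X \<inter> (cylinder t - (F - {x}))"
      using finite_member_below_neighbourhood[OF HFD net(1) net(2)] by metis
    then show ?thesis
      by blast
  qed
  show ?thesis
  proof (cases "\<exists>k. {x} \<in> M k")
    case True
    then obtain k where k: "{x} \<in> M k" ..
    obtain h where h: "\<And>k. h k \<in> M k \<and> x \<in> h k \<and> h k \<subseteq> cylinder t"
      using choice[OF finite.emptyI] by metis
    have "\<forall>j. (h(k := {x})) j \<in> M j \<and> x \<in> (h(k := {x})) j \<and> (h(k := {x})) j \<subseteq> cylinder t"
      using h k t(2) by simp
    moreover have "(h(k := {x})) k \<subseteq> cylinder s" if "x \<in> cylinder s" for s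
      using that by simp
    ultimately show ?thesis
      by blast
  next
    case False
    define P where "P f k N \<longleftrightarrow> N \<in> M k \<and> finite N \<and> x \<in> N \<and> N \<subseteq> cylinder t \<and>
      (N - {x}) \<inter> (\<Union>i<k. f i) = {}" for f k N
    have "\<exists>g. \<forall>k. P g k (g k)"
    proof (rule dependent_wf_choice[OF wf_less_than])
      fix k and f
      assume "\<And>i. (i, k) \<in> less_than \<Longrightarrow> P f i (f i)"
      then have "finite (\<Union>i<k. f i)"
        by (auto simp: P_def)
      then show "\<exists>N. P f k N"
        unfolding P_def by (rule choice)
    qed (auto simp: P_def)
    then obtain g where g: "\<And>k. P g k (g k)"
      by blast
    define A where "A k = g k - {x}" for k
    have "A i \<inter> A j = {}" if "i < j" for i j
      using g[of j] that by (auto simp: P_def A_def)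
    then have "disjoint_family A"
      unfolding disjoint_family_on_def by (metis Int_commute linorder_neqE_nat)
    moreover have "A k \<noteq> {} \<and> finite (A k) \<and> A k \<subseteq> X" for k
    proof -
      have "g k \<noteq> {x}" "finite (g k)" "x \<in> g k" "g k \<in> M k"
        using g[of k] False by (auto simp: P_def)
      moreover from \<open>g k \<in> M k\<close> have "g k \<subseteq> X"
        using net(2)[of k] by (auto simp: network_of_def)
      ultimately show ?thesis
        by (auto simp: A_def)
    qed
    ultimately obtain \<beta>
      where \<beta>: "\<And>s. s \<in> Fin2 {\<beta>..} \<Longrightarrow> infinite {k. A k \<subseteq> cylinder s}"
      using HFD unfolding very_strong_HFD_def by meson
    have "\<exists>k. g k \<subseteq> cylinder s" if "s \<in> Fin2 {\<beta>..}" "x \<in> cylinder s" for s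
    proof -
      have "{k. A k \<subseteq> cylinder s} \<noteq> {}"
        using \<beta>[OF that(1)] by (metis finite.emptyI)
      then show ?thesis
        using that(2) by (auto simp: A_def)
    qed
    moreover have "\<forall>k. g k \<in> M k \<and> x \<in> g k \<and> g k \<subseteq> cylinder t"
      using g by (auto simp: P_def)
    ultimately show ?thesis
      by blast
  qed
qed


section \<open>Selection at all points\<close>

text \<open>
  The networks are distributed over the pairs \<open>(x, t)\<close> by means of \<open>prod_encode\<close>: the \<open>j\<close>-th pair
  selects from the networks with numbers \<open>prod_encode (j, k)\<close>. Selections are prepared for every
  \<open>x\<close>, \<open>t\<close> and \<open>j\<close>, before \<open>\<delta>\<close> and the enumeration of the pairs are known.
\<close>

lemma network_selection:
  fixes \<N> :: "nat \<Rightarrow> (omega1 \<Rightarrow> bool) set set"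
  assumes "X \<noteq> {}" and "countable X" and HFD: "very_strong_HFD X"
    and net: "\<And>n. countable (\<N> n)" "\<And>n. network_of (subtopology cantor_omega1 X) (\<N> n)"
  shows "\<exists>N. (\<forall>n. N n \<in> \<N> n) \<and> network_of (subtopology cantor_omega1 X) (range N)"
proof -
  define select where "select x t j g \<beta> \<longleftrightarrow>
    (\<forall>k. g k \<in> \<N> (prod_encode (j, k)) \<and> x \<in> g k \<and> g k \<subseteq> cylinder t) \<and>
    (\<forall>s \<in> Fin2 {\<beta>..}. x \<in> cylinder s \<longrightarrow> (\<exists>k. g k \<subseteq> cylinder s))" for x t j g \<beta>
  have "\<exists>g \<beta>. select x t j g \<beta>" if "x \<in> X" "t \<in> Fin2 UNIV" "x \<in> cylinder t" for x t j
    unfolding select_def by (intro selection_at_point[OF HFD net(1) net(2) that(2,3,1)])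
  then obtain g \<beta> where select: "\<And>x t j. x \<in> X \<Longrightarrow> t \<in> Fin2 UNIV \<Longrightarrow> x \<in> cylinder t \<Longrightarrow>
      select x t j (g x t j) (\<beta> x t j)"
    by metis
  have g: "g x t j k \<in> \<N> (prod_encode (j, k)) \<and> x \<in> g x t j k \<and> g x t j k \<subseteq> cylinder t"
    if "x \<in> X" "t \<in> Fin2 UNIV" "x \<in> cylinder t" for x t j k
    using select[OF that] by (simp add: select_def)
  have \<beta>: "\<exists>k. g x t j k \<subseteq> cylinder s"
    if "x \<in> X" "t \<in> Fin2 UNIV" "x \<in> cylinder t" "s \<in> Fin2 {\<beta> x t j..}" "x \<in> cylinder s" for x t j s
    using select[OF that(1-3)] that(4,5) by (simp add: select_def)
  have "\<exists>b. \<forall>x\<in>X. \<forall>j::nat. \<beta> x t j \<le> b" for t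
  proof -
    have "countable ((\<lambda>(x, j). \<beta> x t j) ` (X \<times> UNIV))"
      using \<open>countable X\<close> by simp
    then obtain b where "\<forall>\<alpha> \<in> (\<lambda>(x, j). \<beta> x t j) ` (X \<times> UNIV). \<alpha> \<le> b"
      using countable_bounded_omega1 by blast
    then have "\<forall>x\<in>X. \<forall>j. \<beta> x t j \<le> b"
      by auto
    then show ?thesis ..
  qed
  then obtain B where B: "\<And>t x j. x \<in> X \<Longrightarrow> \<beta> x t j \<le> B t"
    by metis
  obtain \<delta> where \<delta>: "\<And>t. t \<in> Fin2 {..<\<delta>} \<Longrightarrow> B t \<le> \<delta>"
    using closing_off_point by metis
  define Q where "Q = {(x, t). x \<in> X \<and> t \<in> Fin2 {..<\<delta>} \<and> x \<in> cylinder t}"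
  have "countable Q"
    by (rule countable_subset[of _ "X \<times> Fin2 {..<\<delta>}"])
      (auto simp: Q_def \<open>countable X\<close> countable_Fin2 countable_lessThan_omega1)
  obtain x0 where "x0 \<in> X"
    using \<open>X \<noteq> {}\<close> by blast
  then have "(x0, Map.empty) \<in> Q"
    by (simp add: Q_def Fin2_def mem_cylinder_iff)
  then have "Q \<noteq> {}"
    by blast
  then have q: "range (from_nat_into Q) = Q"
    using \<open>countable Q\<close> by (rule range_from_nat_into)
  define N where "N n = (case prod_decode n of (j, k) \<Rightarrow>
    case from_nat_into Q j of (x, t) \<Rightarrow> g x t j k)" for n
  have Fin2_UNIV: "t \<in> Fin2 UNIV" if "t \<in> Fin2 I" for I and t :: "omega1 \<rightharpoonup> bool"
    using that by (auto simp: Fin2_def)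
  have N_in: "N n \<in> \<N> n" for n
  proof -
    obtain j k where n: "prod_decode n = (j, k)"
      by fastforce
    then have n': "prod_encode (j, k) = n"
      by (metis prod_decode_inverse)
    obtain x t where xt: "from_nat_into Q j = (x, t)"
      by fastforce
    then have "(x, t) \<in> Q"
      using q by (metis rangeI)
    then have "g x t j k \<in> \<N> (prod_encode (j, k))"
      using g Fin2_UNIV by (auto simp: Q_def)
    then show ?thesis
      using n n' xt by (simp add: N_def)
  qed
  have "\<exists>N' \<in> range N. x \<in> N' \<and> N' \<subseteq> U"
    if x: "x \<in> X" "x \<in> U" and U: "openin (subtopology cantor_omega1 X) U" for x U
  proof -
    obtain V where V: "openin cantor_omega1 V" "U = V \<inter> X"
      using U by (auto simp: openin_subtopology)
    obtain s where s: "s \<in> Fin2 UNIV" "x \<in> cylinder s" "cylinder s \<subseteq> V"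
      using cylinder_in_neighbourhood[OF V(1)] x V(2) by blast
    define t where "t = s |` {..<\<delta>}"
    define u where "u = s |` {\<delta>..}"
    have t: "t \<in> Fin2 {..<\<delta>}" "x \<in> cylinder t" and u: "u \<in> Fin2 {\<delta>..}" "x \<in> cylinder u"
      using s(1,2) by (auto simp: t_def u_def Fin2_def mem_cylinder_iff)
    have split: "cylinder t \<inter> cylinder u \<subseteq> cylinder s"
    proof
      fix f assume f: "f \<in> cylinder t \<inter> cylinder u"
      have "s i = Some (f i)" if "i \<in> dom s" for i
        using f that by (cases "i < \<delta>")
          (auto simp: t_def u_def mem_cylinder_iff not_less)
      then show "f \<in> cylinder s"
        by (simp add: mem_cylinder_iff)
    qed
    have "(x, t) \<in> Q"
      using x t by (simp add: Q_def)
    then obtain j where j: "from_nat_into Q j = (x, t)"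
      using q by (metis rangeE)
    have "\<beta> x t j \<le> \<delta>"
      using B[OF x(1)] \<delta>[OF t(1)] order_trans by blast
    then have "u \<in> Fin2 {\<beta> x t j..}"
      using u(1) by (auto simp: Fin2_def)
    then obtain k where "g x t j k \<subseteq> cylinder u"
      using \<beta>[OF x(1) Fin2_UNIV[OF t(1)] t(2) _ u(2)] by blast
    moreover have "x \<in> g x t j k" "g x t j k \<subseteq> cylinder t"
      using g[OF x(1) Fin2_UNIV[OF t(1)] t(2)] by auto
    moreover have N_eq: "N (prod_encode (j, k)) = g x t j k"
      by (simp add: N_def j)
    moreover have "N (prod_encode (j, k)) \<subseteq> X"
      using N_in net(2) by (fastforce simp: network_of_def)
    ultimately have "x \<in> N (prod_encode (j, k))" "N (prod_encode (j, k)) \<subseteq> U"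
      using split s(3) V(2) by auto
    then show ?thesis
      by blast
  qed
  moreover have "N n \<subseteq> X" for n
    using N_in net(2) by (fastforce simp: network_of_def)
  ultimately have "network_of (subtopology cantor_omega1 X) (range N)"
    by (auto simp: network_of_def)
  then show ?thesis
    using N_in by blast
qed

theorem theorem6p6:
  fixes X :: "(omega1 \<Rightarrow> bool) set"
  assumes "X \<noteq> {}"
    and "countable X"
    and "very_strong_HFD X"
  shows "R_nw_selective (subtopology cantor_omega1 X)"
proof -
  have "network_of (subtopology cantor_omega1 X) ((\<lambda>x. {x}) ` X)"
    by (auto simp: network_of_def)
  then have "\<exists>\<N>. countable \<N> \<and> network_of (subtopology cantor_omega1 X) \<N>"
    using \<open>countable X\<close> by blast
  moreover have "\<exists>N. (\<forall>n. N n \<in> \<N> n) \<and> network_of (subtopology cantor_omega1 X) (range N)"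
    if "\<forall>n. countable (\<N> n) \<and> network_of (subtopology cantor_omega1 X) (\<N> n)"
    for \<N> :: "nat \<Rightarrow> (omega1 \<Rightarrow> bool) set set"
    using that by (intro network_selection[OF assms]) simp_all
  ultimately show ?thesis
    by (simp add: R_nw_selective_def)
qed

end
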